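(* Let $\mathscr{M}$ be a von Neumann algebra acting on the Hilbert space $\mathcal{H}$. A closed operator $T$ on $\mathcal{H}$ (not necessarily densely-defined) is in $\mathscr{M}_{\mathrm{aff}}^{\mathrm{MvN}}$ if and only if its characteristic projection $\chi(T)$ is in $M_2(\mathscr{M})$.
   Context: $\mathscr{M}_{\mathrm{aff}}^{\mathrm{MvN}}$ is the set of closed (not necessarily densely-defined) linear operators $T$ with domain and range in $\mathcal{H}$ such that $U^*TU=T$ (including equality of domains) for every unitary $U$ in the commutant $\mathscr{M}'$. The characteristic projection $\chi(T)$ is the orthogonal projection from $\mathcal{H}\oplus\mathcal{H}$ onto the closure of the graph $\{(x,Tx):x\in\mathrm{dom}(T)\}$, regarded as a $2\times2$ matrix of operators in $\mathcal{B}(\mathcal{H})$ via $\mathcal{B}(\mathcal{H}\oplus\mathcal{H})\cong M_2(\mathcal{B}(\mathcal{H}))$. *)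

theory Defs
  imports "HOL-Analysis.Analysis"
begin

section \<open>Complex Hilbert spaces\<close>

class complex_vector = real_vector +
  fixes scaleC :: "complex \<Rightarrow> 'a \<Rightarrow> 'a" (infixr "*\<^sub>C" 75)
  assumes scaleC_add_right: "c *\<^sub>C (x + y) = c *\<^sub>C x + c *\<^sub>C y"
    and scaleC_add_left: "(c + d) *\<^sub>C x = c *\<^sub>C x + d *\<^sub>C x"
    and scaleC_scaleC: "c *\<^sub>C d *\<^sub>C x = (c * d) *\<^sub>C x"
    and scaleR_scaleC: "r *\<^sub>R x = complex_of_real r *\<^sub>C x"

text \<open>The complex inner product is linear in the first argument.  The norm comes from
  \<open>real_inner\<close>; the last axiom makes it the norm of the complex inner product, since
  \<open>cinner x x\<close> is real by conjugate symmetry.\<close>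

class complex_inner = complex_vector + real_inner +
  fixes cinner :: "'a \<Rightarrow> 'a \<Rightarrow> complex"
  assumes cinner_commute: "cinner x y = cnj (cinner y x)"
    and cinner_add_left: "cinner (x + y) z = cinner x z + cinner y z"
    and cinner_scaleC_left: "cinner (c *\<^sub>C x) y = c * cinner x y"
    and inner_eq_Re_cinner: "inner x y = Re (cinner x y)"

class chilbert_space = complex_inner + complete_space

instantiation complex :: chilbert_space
begin
definition scaleC_complex :: "complex \<Rightarrow> complex \<Rightarrow> complex"
  where "scaleC_complex c x = c * x"
definition cinner_complex :: "complex \<Rightarrow> complex \<Rightarrow> complex"
  where "cinner_complex x y = x * cnj y"
instance
  by standard
    (simp_all add: scaleC_complex_def cinner_complex_def algebra_simps scaleR_conv_of_real
      inner_complex_def)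
end

text \<open>The direct sum of two Hilbert spaces; norm, topology and completeness are those of the
  library's product type.\<close>

instantiation prod :: (complex_vector, complex_vector) complex_vector
begin
definition scaleC_prod :: "complex \<Rightarrow> 'a \<times> 'b \<Rightarrow> 'a \<times> 'b"
  where "scaleC_prod c p = (c *\<^sub>C fst p, c *\<^sub>C snd p)"
instance
  by standard
    (simp_all add: scaleC_prod_def scaleC_add_right scaleC_add_left scaleC_scaleC
      prod_eq_iff scaleR_scaleC)
end

instantiation prod :: (complex_inner, complex_inner) complex_inner
begin
definition cinner_prod :: "'a \<times> 'b \<Rightarrow> 'a \<times> 'b \<Rightarrow> complex"
  where "cinner_prod p q = cinner (fst p) (fst q) + cinner (snd p) (snd q)"
instance
proof
  fix x y z :: "'a \<times> 'b" and c :: complex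
  show "cinner x y = cnj (cinner y x)"
    unfolding cinner_prod_def complex_cnj_add
    by (metis cinner_commute)
  show "cinner (x + y) z = cinner x z + cinner y z"
    by (simp add: cinner_prod_def cinner_add_left)
  show "cinner (c *\<^sub>C x) y = c * cinner x y"
    by (simp add: cinner_prod_def scaleC_prod_def cinner_scaleC_left algebra_simps)
  show "inner x y = Re (cinner x y)"
    by (simp add: cinner_prod_def inner_prod_def inner_eq_Re_cinner)
qed
end

instance prod :: (chilbert_space, chilbert_space) chilbert_space ..

section \<open>Von Neumann algebras\<close>

definition bounded_ops :: "('a::chilbert_space \<Rightarrow> 'a) set"
  where "bounded_ops = {A. bounded_linear A \<and> (\<forall>c x. A (c *\<^sub>C x) = c *\<^sub>C A x)}"

definition cadjoint :: "('a::chilbert_space \<Rightarrow> 'a) \<Rightarrow> 'a \<Rightarrow> 'a"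
  where "cadjoint A = (THE B. \<forall>x y. cinner (A x) y = cinner x (B y))"

definition unitary :: "('a::chilbert_space \<Rightarrow> 'a) \<Rightarrow> bool"
  where "unitary U \<longleftrightarrow> U \<in> bounded_ops \<and> cadjoint U \<circ> U = id \<and> U \<circ> cadjoint U = id"

definition commutant :: "('a::chilbert_space \<Rightarrow> 'a) set \<Rightarrow> ('a \<Rightarrow> 'a) set"
  where "commutant M = {A \<in> bounded_ops. \<forall>B\<in>M. A \<circ> B = B \<circ> A}"

text \<open>\<open>euclidean\<close> on \<open>'a \<times> 'a \<Rightarrow> complex\<close> is the topology of pointwise convergence, so this is the
  coarsest topology on the bounded operators for which all \<open>A \<mapsto> cinner (A x) y\<close> are continuous.\<close>

definition weak_operator_topology :: "('a::chilbert_space \<Rightarrow> 'a) topology"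
  where "weak_operator_topology =
    pullback_topology bounded_ops (\<lambda>A (x, y). cinner (A x) y)
      (euclidean :: ('a \<times> 'a \<Rightarrow> complex) topology)"

definition von_neumann_algebra :: "('a::chilbert_space \<Rightarrow> 'a) set \<Rightarrow> bool"
  where "von_neumann_algebra M \<longleftrightarrow>
    M \<subseteq> bounded_ops \<and> id \<in> M \<and>
    (\<forall>A\<in>M. \<forall>B\<in>M. (\<lambda>x. A x + B x) \<in> M) \<and>
    (\<forall>c. \<forall>A\<in>M. (\<lambda>x. c *\<^sub>C A x) \<in> M) \<and>
    (\<forall>A\<in>M. \<forall>B\<in>M. A \<circ> B \<in> M) \<and>
    (\<forall>A\<in>M. cadjoint A \<in> M) \<and>
    closedin weak_operator_topology M"

section \<open>Closed operators and affiliation\<close>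

text \<open>An operator with domain a linear subspace of \<open>'a\<close> is a partial map, so that equality of
  operators includes equality of domains.\<close>

definition linear_operator :: "('a::chilbert_space \<rightharpoonup> 'a) \<Rightarrow> bool"
  where "linear_operator T \<longleftrightarrow>
    T 0 = Some 0 \<and>
    (\<forall>x y u v. T x = Some u \<longrightarrow> T y = Some v \<longrightarrow> T (x + y) = Some (u + v)) \<and>
    (\<forall>c x u. T x = Some u \<longrightarrow> T (c *\<^sub>C x) = Some (c *\<^sub>C u))"

definition closed_operator :: "('a::chilbert_space \<rightharpoonup> 'a) \<Rightarrow> bool"
  where "closed_operator T \<longleftrightarrow> linear_operator T \<and> closed (Map.graph T)"

definition mvn_affiliated :: "('a::chilbert_space \<Rightarrow> 'a) set \<Rightarrow> ('a \<rightharpoonup> 'a) set"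
  where "mvn_affiliated M =
    {T. closed_operator T \<and>
      (\<forall>U \<in> commutant M. unitary U \<longrightarrow> (Some \<circ> cadjoint U) \<circ>\<^sub>m T \<circ>\<^sub>m (Some \<circ> U) = T)}"

section \<open>The characteristic projection\<close>

definition orth_proj :: "'a::chilbert_space set \<Rightarrow> 'a \<Rightarrow> 'a"
  where "orth_proj S x = (THE p. p \<in> S \<and> (\<forall>s\<in>S. cinner (x - p) s = 0))"

definition char_proj :: "('a::chilbert_space \<rightharpoonup> 'a) \<Rightarrow> 'a \<times> 'a \<Rightarrow> 'a \<times> 'a"
  where "char_proj T = orth_proj (closure (Map.graph T))"

text \<open>The identification of operators on the direct sum with \<open>2 \<times> 2\<close> matrices of operators: the
  entry \<open>(i, j)\<close> is the operator from the \<open>j\<close>-th to the \<open>i\<close>-th summand.\<close>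

definition summand_inj :: "2 \<Rightarrow> 'a::chilbert_space \<Rightarrow> 'a \<times> 'a"
  where "summand_inj j x = (if j = 1 then (x, 0) else (0, x))"

definition summand_proj :: "2 \<Rightarrow> 'a::chilbert_space \<times> 'a \<Rightarrow> 'a"
  where "summand_proj i p = (if i = 1 then fst p else snd p)"

definition op_matrix :: "('a::chilbert_space \<times> 'a \<Rightarrow> 'a \<times> 'a) \<Rightarrow> ('a \<Rightarrow> 'a) ^ 2 ^ 2"
  where "op_matrix P = (\<chi> i j. summand_proj i \<circ> P \<circ> summand_inj j)"

definition mat2 :: "('a \<Rightarrow> 'a) set \<Rightarrow> (('a \<Rightarrow> 'a) ^ 2 ^ 2) set"
  where "mat2 M = {A. \<forall>i j. A $ i $ j \<in> M}"

end

(* A closed operator is affiliated with M iff its graph G is invariant under U + U (direct sum) for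
   all unitaries U in the commutant M'; since M' is self-adjoint, this says that the projection P onto
   G commutes with U + U, i.e. that the matrix entries of P commute with the unitaries of M'.  By
   Cayley transforms these unitaries determine all of M', and the double commutant theorem puts the
   entries of P into M. *)

theory Submission
  imports Defs
begin

section \<open>The complex inner product\<close>

text \<open>The textbook way from unitaries to all of a commutant writes an operator as a
  combination of four unitaries and needs square roots of positive operators. The Cayley transform
  of a self-adjoint \<open>A\<close> needs only an inverse of \<open>1 - \<i>A\<close>, and
  commutation with \<open>A\<close> can be tested on a multiple small enough to be a strict
  contraction, so a fixed point argument suffices. \<open>M\<close> is closed in the weak operator
  topology, whose basic neighbourhoods test finitely many pairs of vectors at the same time.
  Approximation at one vector is therefore not enough: one has to project onto the closed orbit of a
  whole finite family under \<open>M\<close>. This is why projections are built for finite families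
  first; closed subspaces of a single space are the case of one index. The domain of
  \<open>T\<close> may fail to be dense, so \<open>T\<close> may have no adjoint; the argument
  touches \<open>T\<close> only through its graph, a closed subspace of the direct sum.\<close>

lemma cinner_add_right: "cinner x (y + z) = cinner x y + cinner x (z::'a::complex_inner)"
  by (metis cinner_add_left cinner_commute complex_cnj_add)

lemma cinner_scaleC_right: "cinner x (c *\<^sub>C y) = cnj c * cinner x (y::'a::complex_inner)"
  by (metis cinner_commute cinner_scaleC_left complex_cnj_mult)

lemma cinner_self: "cinner x x = complex_of_real ((norm (x::'a::complex_inner))\<^sup>2)"
proof -
  have "Im (cinner x x) = 0"
    using arg_cong[OF cinner_commute[of x x], of Im] by simp
  then show ?thesis
    by (simp add: complex_eq_iff inner_eq_Re_cinner[symmetric] power2_norm_eq_inner)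
qed

lemma norm_scaleC: "norm (c *\<^sub>C x) = cmod c * norm (x::'a::complex_inner)"
proof -
  have "cinner (c *\<^sub>C x) (c *\<^sub>C x) = (c * cnj c) * cinner x x"
    by (simp add: cinner_scaleC_left cinner_scaleC_right)
  then have "complex_of_real ((norm (c *\<^sub>C x))\<^sup>2) = complex_of_real ((cmod c * norm x)\<^sup>2)"
    by (simp only: cinner_self complex_norm_square[symmetric] of_real_mult power_mult_distrib)
  then have "(norm (c *\<^sub>C x))\<^sup>2 = (cmod c * norm x)\<^sup>2"
    using of_real_eq_iff by blast
  then show ?thesis
    by (simp add: power2_eq_iff_nonneg)
qed

lemma norm_cinner_le: "cmod (cinner x y) \<le> norm x * norm (y::'a::complex_inner)"
proof (cases "cinner x y = 0")
  case False
  \<comment> \<open>A phase that turns \<open>cinner x y\<close> into its modulus, so that the real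
    Cauchy-Schwarz inequality applies to \<open>c *\<^sub>C x\<close> and \<open>y\<close>.\<close>
  define c where "c = cnj (cinner x y) / complex_of_real (cmod (cinner x y))"
  have "c * cinner x y = complex_of_real (cmod (cinner x y))"
    using False by (simp add: c_def mult.commute[of "cnj _"] complex_norm_square[symmetric] power2_eq_square)
  then have "cmod (cinner x y) = inner (c *\<^sub>C x) y"
    by (simp add: inner_eq_Re_cinner cinner_scaleC_left)
  also have "\<dots> \<le> norm (c *\<^sub>C x) * norm y"
    by (rule norm_cauchy_schwarz)
  also have "cmod c = 1"
    using False by (simp add: c_def norm_divide)
  then have "norm (c *\<^sub>C x) = norm x"
    by (simp add: norm_scaleC)
  finally show ?thesis .
qed simp

lemma bounded_bilinear_cinner: "bounded_bilinear (cinner :: 'a::complex_inner \<Rightarrow> 'a \<Rightarrow> complex)"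
proof
  show "\<exists>K. \<forall>a b :: 'a. cmod (cinner a b) \<le> norm a * norm b * K"
    using norm_cinner_le by (metis mult.right_neutral)
qed (simp_all add: cinner_add_left cinner_add_right scaleR_scaleC cinner_scaleC_left
    cinner_scaleC_right scaleC_complex_def)

interpretation cinner: bounded_bilinear "cinner :: 'a::complex_inner \<Rightarrow> 'a \<Rightarrow> complex"
  by (rule bounded_bilinear_cinner)

lemmas cinner_simps = cinner.add_left cinner.add_right cinner.diff_left cinner.diff_right
  cinner.minus_left cinner.minus_right cinner_scaleC_left cinner_scaleC_right

lemma bounded_linear_scaleC: "bounded_linear (\<lambda>x::'a::complex_inner. c *\<^sub>C x)"
  by (rule bounded_linear_intro[where K = "cmod c"])
    (simp_all add: scaleC_add_right scaleR_scaleC scaleC_scaleC mult.commute norm_scaleC)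

lemmas scaleC_zero_right = linear_0[OF bounded_linear.linear[OF bounded_linear_scaleC]]
lemmas scaleC_diff = linear_diff[OF bounded_linear.linear[OF bounded_linear_scaleC]]

lemma scaleC_one [simp]: "1 *\<^sub>C x = (x::'a::complex_vector)"
  using scaleR_scaleC[of 1 x] by simp

lemma scaleC_minus_one: "(- 1) *\<^sub>C x = - (x::'a::complex_vector)"
  using scaleR_scaleC[of "- 1" x] by simp

lemma scaleC_half: "(1 / 2) *\<^sub>C x = (1 / 2) *\<^sub>R (x::'a::complex_vector)"
  by (simp add: scaleR_scaleC)

lemma norm_add_square:
  "(norm (x + y))\<^sup>2 = (norm x)\<^sup>2 + (norm y)\<^sup>2 + 2 * Re (cinner x (y::'a::complex_inner))"
  by (simp add: power2_norm_eq_inner inner_add_left inner_add_right inner_commute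
      inner_eq_Re_cinner[symmetric])

lemma cinner_eq_zero_all: "(\<And>y. cinner x y = 0) \<Longrightarrow> x = (0::'a::complex_inner)"
  by (metis cinner_self norm_eq_zero of_real_eq_0_iff zero_eq_power2)

lemma cinner_right_eqI: "(\<And>y. cinner y x = cinner y z) \<Longrightarrow> x = (z::'a::complex_inner)"
  by (metis cinner.diff_right cinner_eq_zero_all cinner_commute complex_cnj_zero eq_iff_diff_eq_0)


section \<open>Orthogonal projection for finite families\<close>

text \<open>The finite direct sum of copies of the Hilbert space is not a type when the number of
  summands varies, so it is replaced by functions on a finite index set \<open>I\<close>, of which only the
  values on \<open>I\<close> matter.\<close>

locale family_subspace =
  fixes I :: "'b set" and S :: "('b \<Rightarrow> 'a::chilbert_space) set"
  assumes finite_index: "finite I"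
    and nonempty: "S \<noteq> {}"
    and add_mem: "s \<in> S \<Longrightarrow> t \<in> S \<Longrightarrow> (\<lambda>i. s i + t i) \<in> S"
    and scaleC_mem: "s \<in> S \<Longrightarrow> (\<lambda>i. c *\<^sub>C s i) \<in> S"
begin

text \<open>Membership in the closure of \<open>S\<close> in the direct sum over \<open>I\<close>,
  phrased coordinate by coordinate so that the values outside \<open>I\<close> cannot influence
  convergence.\<close>

definition limit_family :: "('b \<Rightarrow> 'a) \<Rightarrow> bool" where
  "limit_family p \<longleftrightarrow> (\<exists>s. (\<forall>k::nat. s k \<in> S) \<and> (\<forall>i\<in>I. (\<lambda>k. s k i) \<longlonglongrightarrow> p i))"

definition is_proj :: "('b \<Rightarrow> 'a) \<Rightarrow> ('b \<Rightarrow> 'a) \<Rightarrow> bool" where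
  "is_proj h p \<longleftrightarrow> limit_family p \<and> (\<forall>s\<in>S. (\<Sum>i\<in>I. cinner (h i - p i) (s i)) = 0)"

text \<open>\<open>SOME\<close> rather than \<open>THE\<close>, because \<open>is_proj\<close>
  constrains its second argument only on \<open>I\<close>.\<close>

definition proj :: "('b \<Rightarrow> 'a) \<Rightarrow> 'b \<Rightarrow> 'a" where
  "proj h = (SOME p. is_proj h p)"

lemma zero_mem: "(\<lambda>i. 0) \<in> S"
proof -
  obtain s where "s \<in> S" using nonempty by blast
  from add_mem[OF this scaleC_mem[OF this, of "- 1"]] show ?thesis
    by (simp add: scaleC_minus_one)
qed

lemma limit_family_mem: "s \<in> S \<Longrightarrow> limit_family s"
  unfolding limit_family_def by (rule exI[of _ "\<lambda>_. s"]) simp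

lemma limit_family_add:
  assumes "limit_family p" "limit_family q"
  shows "limit_family (\<lambda>i. p i + q i)"
proof -
  obtain s t where "\<forall>k. s k \<in> S" "\<forall>i\<in>I. (\<lambda>k. s k i) \<longlonglongrightarrow> p i"
    "\<forall>k. t k \<in> S" "\<forall>i\<in>I. (\<lambda>k. t k i) \<longlonglongrightarrow> q i"
    using assms unfolding limit_family_def by metis
  then show ?thesis
    unfolding limit_family_def
    by (intro exI[of _ "\<lambda>k i. s k i + t k i"]) (auto intro: add_mem tendsto_add)
qed

lemma limit_family_scaleC:
  assumes "limit_family p"
  shows "limit_family (\<lambda>i. c *\<^sub>C p i)"
proof -
  obtain s where "\<forall>k. s k \<in> S" "\<forall>i\<in>I. (\<lambda>k. s k i) \<longlonglongrightarrow> p i"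
    using assms unfolding limit_family_def by metis
  then show ?thesis
    unfolding limit_family_def
    by (intro exI[of _ "\<lambda>k i. c *\<^sub>C s k i"]) (auto intro: scaleC_mem bounded_linear.tendsto[OF bounded_linear_scaleC])
qed

lemma orthogonal_limit_family:
  assumes "\<And>s. s \<in> S \<Longrightarrow> (\<Sum>i\<in>I. cinner (f i) (s i)) = 0" and "limit_family p"
  shows "(\<Sum>i\<in>I. cinner (f i) (p i)) = 0"
proof -
  obtain s where s: "\<And>k. s k \<in> S" "\<And>i. i \<in> I \<Longrightarrow> (\<lambda>k. s k i) \<longlonglongrightarrow> p i"
    using assms(2) unfolding limit_family_def by metis
  have "(\<lambda>k. \<Sum>i\<in>I. cinner (f i) (s k i)) \<longlonglongrightarrow> (\<Sum>i\<in>I. cinner (f i) (p i))"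
    by (intro tendsto_sum cinner.tendsto tendsto_const s)
  then show ?thesis
    using assms(1) s(1) LIMSEQ_unique[OF _ tendsto_const[of 0]] by simp
qed

lemma is_proj_add:
  assumes "is_proj h p" "is_proj k q"
  shows "is_proj (\<lambda>i. h i + k i) (\<lambda>i. p i + q i)"
proof -
  have "(\<Sum>i\<in>I. cinner (h i + k i - (p i + q i)) (s i)) = 0" if "s \<in> S" for s
  proof -
    have "(\<Sum>i\<in>I. cinner (h i + k i - (p i + q i)) (s i)) =
      (\<Sum>i\<in>I. cinner (h i - p i) (s i)) + (\<Sum>i\<in>I. cinner (k i - q i) (s i))"
      by (simp add: sum.distrib[symmetric] cinner_simps algebra_simps)
    then show ?thesis using assms that by (simp add: is_proj_def)
  qed
  then show ?thesis using assms by (simp add: is_proj_def limit_family_add)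
qed

lemma is_proj_scaleC:
  assumes "is_proj h p"
  shows "is_proj (\<lambda>i. c *\<^sub>C h i) (\<lambda>i. c *\<^sub>C p i)"
  using assms by (simp add: is_proj_def limit_family_scaleC scaleC_diff[symmetric]
      cinner_scaleC_left sum_distrib_left[symmetric])

text \<open>Pythagoras: orthogonality to \<open>S\<close> passes to limits, so \<open>h - p\<close>
  is orthogonal to \<open>p\<close> itself.\<close>

lemma is_proj_norm_le:
  assumes "is_proj h p"
  shows "(\<Sum>i\<in>I. (norm (p i))\<^sup>2) \<le> (\<Sum>i\<in>I. (norm (h i))\<^sup>2)"
proof -
  have 0: "(\<Sum>i\<in>I. cinner (h i - p i) (p i)) = 0"
    by (rule orthogonal_limit_family) (use assms in \<open>auto simp: is_proj_def\<close>)
  have "(norm (h i))\<^sup>2 = (norm (h i - p i))\<^sup>2 + (norm (p i))\<^sup>2 + 2 * Re (cinner (h i - p i) (p i))" for i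
    using norm_add_square[of "h i - p i" "p i"] by simp
  then have "(\<Sum>i\<in>I. (norm (h i))\<^sup>2) = (\<Sum>i\<in>I. (norm (h i - p i))\<^sup>2) + (\<Sum>i\<in>I. (norm (p i))\<^sup>2)
     + 2 * Re (\<Sum>i\<in>I. cinner (h i - p i) (p i))"
    by (simp add: sum.distrib sum_distrib_left)
  then show ?thesis by (simp add: 0 sum_nonneg)
qed

text \<open>By linearity \<open>p - q\<close> is a projection of the zero family, and a projection
  does not increase the norm.\<close>

lemma is_proj_unique:
  assumes "is_proj h p" "is_proj h q" "i \<in> I"
  shows "p i = q i"
proof -
  have "is_proj (\<lambda>i. 0) (\<lambda>i. p i - q i)"
    using is_proj_add[OF assms(1) is_proj_scaleC[OF assms(2), of "- 1"]]
    by (simp add: scaleC_minus_one)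
  from is_proj_norm_le[OF this] have "(\<Sum>i\<in>I. (norm (p i - q i))\<^sup>2) \<le> 0"
    by simp
  then have "(\<Sum>i\<in>I. (norm (p i - q i))\<^sup>2) = 0"
    by (simp add: antisym sum_nonneg)
  then show ?thesis
    using assms(3) finite_index by (simp add: sum_nonneg_eq_0_iff)
qed

text \<open>The limit of a sequence in \<open>S\<close> that minimises the squared distance to
  \<open>h\<close>: the parallelogram law makes the sequence converge, and minimality forces
  orthogonality.\<close>

lemma is_proj_ex: "\<exists>p. is_proj h p"
proof -
  define q where "q f = (\<Sum>i\<in>I. (norm (f i))\<^sup>2)" for f :: "'b \<Rightarrow> 'a"
  define d where "d = (INF s\<in>S. q (\<lambda>i. h i - s i))"
  have bdd: "bdd_below ((\<lambda>s. q (\<lambda>i. h i - s i)) ` S)"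
    by (rule bdd_belowI2[of _ 0]) (simp add: q_def sum_nonneg)
  have d_le: "d \<le> q (\<lambda>i. h i - s i)" if "s \<in> S" for s
    unfolding d_def using bdd that by (rule cINF_lower)
  have "\<exists>s\<in>S. q (\<lambda>i. h i - s i) < d + 1 / Suc k" for k
    by (rule iffD1[OF cINF_less_iff[OF nonempty bdd]]) (simp add: d_def[symmetric])
  then obtain s where s: "\<And>k. s k \<in> S" "\<And>k. q (\<lambda>i. h i - s k i) < d + 1 / Suc k"
    by metis
  have par: "q (\<lambda>i. s k i - s l i) \<le> 2 / Suc k + 2 / Suc l" for k l
  proof -
    \<comment> \<open>Parallelogram law for \<open>z - x\<close> and \<open>z - y\<close>. The
      midpoint of two members of \<open>S\<close> is again in \<open>S\<close>, so after summation
      the subtracted term is at least \<open>4 * d\<close>.\<close>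
    have *: "(norm (x - y))\<^sup>2 = 2 * (norm (z - x))\<^sup>2 + 2 * (norm (z - y))\<^sup>2
        - 4 * (norm (z - (1 / 2) *\<^sub>R (x + y)))\<^sup>2" for x y z :: 'a
      by (simp add: power2_norm_eq_inner inner_commute algebra_simps)
    have "q (\<lambda>i. s k i - s l i) = (\<Sum>i\<in>I. 2 * (norm (h i - s k i))\<^sup>2 + 2 * (norm (h i - s l i))\<^sup>2
        - 4 * (norm (h i - (1 / 2) *\<^sub>R (s k i + s l i)))\<^sup>2)"
      unfolding q_def by (intro sum.cong refl *)
    also have "\<dots> = 2 * q (\<lambda>i. h i - s k i) + 2 * q (\<lambda>i. h i - s l i)
        - 4 * q (\<lambda>i. h i - (1 / 2) *\<^sub>R (s k i + s l i))"
      by (simp add: q_def sum.distrib sum_subtractf sum_distrib_left)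
    finally have "q (\<lambda>i. s k i - s l i) = 2 * q (\<lambda>i. h i - s k i) + 2 * q (\<lambda>i. h i - s l i)
        - 4 * q (\<lambda>i. h i - (1 / 2) *\<^sub>R (s k i + s l i))" .
    moreover have "d \<le> q (\<lambda>i. h i - (1 / 2) *\<^sub>R (s k i + s l i))"
      using d_le[OF scaleC_mem[OF add_mem[OF s(1) s(1)], of "1 / 2"]] by (simp only: scaleC_half)
    ultimately show ?thesis using s(2)[of k] s(2)[of l] by simp
  qed
  have "convergent (\<lambda>k. s k i)" if i: "i \<in> I" for i
  proof (rule Cauchy_convergent, rule metric_CauchyI)
    fix e :: real assume "e > 0"
    \<comment> \<open>Beyond \<open>N\<close> the two fractions in \<open>par\<close> are at most
      \<open>2 / N\<close> each, so the squared distance is at most \<open>4 / N\<close>.\<close>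
    obtain N where N: "4 / e\<^sup>2 < real N" using reals_Archimedean2 by blast
    moreover have "0 < 4 / e\<^sup>2" using \<open>e > 0\<close> by simp
    ultimately have "N > 0" by (metis less_trans of_nat_0_less_iff)
    have "dist (s k i) (s l i) < e" if "k \<ge> N" "l \<ge> N" for k l
    proof -
      have *: "2 / Suc m \<le> 2 / real N" if "m \<ge> N" for m
        using that \<open>N > 0\<close> by (intro divide_left_mono) auto
      have "(norm (s k i - s l i))\<^sup>2 \<le> q (\<lambda>i. s k i - s l i)"
        unfolding q_def using i finite_index by (intro member_le_sum) auto
      also have "\<dots> \<le> 4 / real N"
        using par[of k l] *[OF that(1)] *[OF that(2)] by simp
      also have "\<dots> < e\<^sup>2"
        using N \<open>e > 0\<close> \<open>N > 0\<close> by (simp add: field_simps)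
      finally show ?thesis
        using \<open>e > 0\<close> by (simp add: dist_norm power_less_imp_less_base)
    qed
    then show "\<exists>M. \<forall>m\<ge>M. \<forall>n\<ge>M. dist (s m i) (s n i) < e" by blast
  qed
  then obtain p where p: "\<And>i. i \<in> I \<Longrightarrow> (\<lambda>k. s k i) \<longlonglongrightarrow> p i"
    unfolding convergent_def by metis
  have lim_p: "limit_family p"
    unfolding limit_family_def using s(1) p by blast
  have q_lim: "(\<lambda>k. q (\<lambda>i. h i - s k i + t i)) \<longlonglongrightarrow> q (\<lambda>i. h i - p i + t i)" for t
    unfolding q_def by (intro tendsto_intros p)
  have q_p: "q (\<lambda>i. h i - p i) \<le> d"
  proof (rule LIMSEQ_le)
    show "(\<lambda>k. q (\<lambda>i. h i - s k i)) \<longlonglongrightarrow> q (\<lambda>i. h i - p i)"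
      using q_lim[of "\<lambda>_. 0"] by simp
    show "(\<lambda>k. d + 1 / Suc k) \<longlonglongrightarrow> d"
      using tendsto_add[OF tendsto_const LIMSEQ_inverse_real_of_nat, of d]
      by (simp add: inverse_eq_divide)
    show "\<exists>N. \<forall>k\<ge>N. q (\<lambda>i. h i - s k i) \<le> d + 1 / Suc k"
      using s(2) less_imp_le by blast
  qed
  have d_min: "d \<le> q (\<lambda>i. h i - p i + t i)" if "t \<in> S" for t
  proof (rule LIMSEQ_le_const[OF q_lim], intro exI allI impI)
    fix k
    show "d \<le> q (\<lambda>i. h i - s k i + t i)"
      using d_le[OF add_mem[OF s(1)[of k] scaleC_mem[OF that, of "- 1"]]]
      by (simp add: scaleC_minus_one algebra_simps)
  qed
  have Re0: "Re (\<Sum>i\<in>I. cinner (h i - p i) (t i)) = 0" if "t \<in> S" for t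
  proof (rule ccontr)
    define a where "a = Re (\<Sum>i\<in>I. cinner (h i - p i) (t i))"
    assume "Re (\<Sum>i\<in>I. cinner (h i - p i) (t i)) \<noteq> 0"
    then have "a \<noteq> 0" by (simp add: a_def)
    have quad: "0 \<le> r\<^sup>2 * q t + 2 * r * a" for r :: real
    proof -
      have "q (\<lambda>i. h i - p i + r *\<^sub>R t i) = q (\<lambda>i. h i - p i) + r\<^sup>2 * q t + 2 * r * a"
        by (simp add: q_def a_def norm_add_square sum.distrib sum_distrib_left cinner.scaleR_right
            power_mult_distrib mult.assoc)
      moreover have "d \<le> q (\<lambda>i. h i - p i + r *\<^sub>R t i)"
        using d_min[OF scaleC_mem[OF that, of "complex_of_real r"]] by (simp add: scaleR_scaleC)
      ultimately show ?thesis using q_p by simp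
    qed
    have "q t \<ge> 0" by (simp add: q_def sum_nonneg)
    \<comment> \<open>For \<open>q t > 0\<close> the quadratic is least at \<open>- a / q t\<close>.
      Adding 1 to the denominator covers \<open>q t = 0\<close> and still makes the value
      negative.\<close>
    define r where "r = - a / (q t + 1)"
    have ra: "a = - r * (q t + 1)"
      using \<open>q t \<ge> 0\<close> by (simp add: r_def)
    have "r \<noteq> 0" using \<open>a \<noteq> 0\<close> \<open>q t \<ge> 0\<close> by (simp add: r_def)
    have "r\<^sup>2 * q t + 2 * r * a = - (r\<^sup>2) * (q t + 2)"
      unfolding ra by (simp add: algebra_simps power2_eq_square)
    also have "\<dots> < 0"
      using \<open>r \<noteq> 0\<close> \<open>q t \<ge> 0\<close> by (simp add: mult_pos_pos)
    finally show False using quad[of r] by simp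
  qed
  have "(\<Sum>i\<in>I. cinner (h i - p i) (t i)) = 0" if "t \<in> S" for t
  proof -
    \<comment> \<open>A factor \<open>\<i>\<close> in the conjugate-linear second argument turns the
      imaginary part into a real part, which is already known to vanish.\<close>
    have "Re (\<Sum>i\<in>I. cinner (h i - p i) (\<i> *\<^sub>C t i)) = Im (\<Sum>i\<in>I. cinner (h i - p i) (t i))"
      by (simp add: cinner_scaleC_right sum_negf)
    then show ?thesis
      using Re0[OF that] Re0[OF scaleC_mem[OF that, of \<i>]] by (simp add: complex_eq_iff)
  qed
  then show ?thesis
    using lim_p unfolding is_proj_def by blast
qed

lemma is_proj_proj: "is_proj h (proj h)"
  unfolding proj_def using is_proj_ex by (rule someI_ex)

lemma proj_eqI: "is_proj h p \<Longrightarrow> i \<in> I \<Longrightarrow> proj h i = p i"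
  using is_proj_unique is_proj_proj by blast

end


section \<open>Orthogonal projection onto a closed subspace\<close>

definition csubspace :: "'a::complex_vector set \<Rightarrow> bool" where
  "csubspace S \<longleftrightarrow> 0 \<in> S \<and> (\<forall>x\<in>S. \<forall>y\<in>S. x + y \<in> S) \<and> (\<forall>c. \<forall>x\<in>S. c *\<^sub>C x \<in> S)"

lemma csubspace_diff: "csubspace S \<Longrightarrow> x \<in> S \<Longrightarrow> y \<in> S \<Longrightarrow> x - y \<in> S"
  unfolding csubspace_def by (metis diff_conv_add_uminus scaleC_minus_one)

lemma orth_proj_unique:
  fixes S :: "'a::chilbert_space set"
  assumes "csubspace S" "p \<in> S" "\<And>s. s \<in> S \<Longrightarrow> cinner (x - p) s = 0"
    "q \<in> S" "\<And>s. s \<in> S \<Longrightarrow> cinner (x - q) s = 0"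
  shows "p = q"
proof -
  have "cinner (x - q) (p - q) - cinner (x - p) (p - q) = 0"
    using assms by (simp add: csubspace_diff)
  then have "cinner (p - q) (p - q) = 0"
    by (simp add: cinner.diff_left[symmetric])
  then show ?thesis
    by (simp add: cinner_self)
qed

text \<open>Families over the one-point index set \<open>{()}\<close> are single vectors, and
  closedness of \<open>S\<close> brings limit families back into \<open>S\<close>.\<close>

lemma orth_proj_ex:
  fixes S :: "'a::chilbert_space set"
  assumes "csubspace S" "closed S"
  shows "\<exists>p\<in>S. \<forall>s\<in>S. cinner (x - p) s = 0"
proof -
  interpret family_subspace "{()}" "(\<lambda>s _. s) ` S"
    using assms(1) by unfold_locales (auto simp: csubspace_def image_iff)
  obtain p where p: "is_proj (\<lambda>_. x) p"
    using is_proj_ex by blast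
  then obtain s where s: "\<And>k. s k \<in> (\<lambda>s _. s) ` S" "(\<lambda>k. s k ()) \<longlonglongrightarrow> p ()"
    unfolding is_proj_def limit_family_def by auto
  have "s k () \<in> S" for k
    using s(1)[of k] by auto
  then have "p () \<in> S"
    using s(2) by (rule closed_sequentially[OF assms(2)])
  moreover have "\<forall>s\<in>S. cinner (x - p ()) s = 0"
    using p by (simp add: is_proj_def)
  ultimately show ?thesis by blast
qed

lemma orth_proj_eqI:
  fixes S :: "'a::chilbert_space set"
  assumes "csubspace S" "p \<in> S" "\<And>s. s \<in> S \<Longrightarrow> cinner (x - p) s = 0"
  shows "orth_proj S x = p"
  unfolding orth_proj_def using assms orth_proj_unique[OF assms(1)] by (intro the_equality) blast+

lemma
  fixes S :: "'a::chilbert_space set"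
  assumes "csubspace S" "closed S"
  shows orth_proj_mem: "orth_proj S x \<in> S"
    and orth_proj_orthogonal: "s \<in> S \<Longrightarrow> cinner (x - orth_proj S x) s = 0"
  using orth_proj_ex[OF assms, of x] orth_proj_eqI[OF assms(1)] by auto

section \<open>Bounded complex-linear operators\<close>

lemma bounded_opsI:
  assumes "\<And>x y. A (x + y) = A x + A y" "\<And>c x. A (c *\<^sub>C x) = c *\<^sub>C A x"
    and "\<And>x. norm (A x) \<le> K * norm x"
  shows "A \<in> bounded_ops"
  unfolding bounded_ops_def using assms
  by (auto intro!: bounded_linear_intro[where K = K] simp: scaleR_scaleC mult.commute)

lemma
  assumes "A \<in> bounded_ops"
  shows bounded_ops_bounded_linear: "bounded_linear A"
    and bounded_ops_scaleC: "A (c *\<^sub>C x) = c *\<^sub>C A x"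
    and bounded_ops_add: "A (x + y) = A x + A y"
    and bounded_ops_diff: "A (x - y) = A x - A y"
    and bounded_ops_zero: "A 0 = 0"
  using assms linear_add linear_diff linear_0 bounded_linear.linear
  unfolding bounded_ops_def by blast+

lemma bounded_ops_sum: "A \<in> bounded_ops \<Longrightarrow> A (\<Sum>i\<in>I. f i) = (\<Sum>i\<in>I. A (f i))"
  by (simp add: linear_sum bounded_linear.linear bounded_ops_bounded_linear)

lemma orth_proj_bounded_ops:
  assumes "csubspace S" "closed S"
  shows "orth_proj S \<in> bounded_ops"
proof (rule bounded_opsI[where K = 1])
  note mem = orth_proj_mem[OF assms] and orth = orth_proj_orthogonal[OF assms]
  fix x y c
  show "orth_proj S (x + y) = orth_proj S x + orth_proj S y"
  proof (rule orth_proj_eqI[OF assms(1)])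
    show "orth_proj S x + orth_proj S y \<in> S"
      using mem assms(1) by (simp add: csubspace_def)
    fix s assume s: "s \<in> S"
    show "cinner (x + y - (orth_proj S x + orth_proj S y)) s = 0"
      using orth[OF s, of x] orth[OF s, of y] by (simp add: cinner_simps)
  qed
  show "orth_proj S (c *\<^sub>C x) = c *\<^sub>C orth_proj S x"
  proof (rule orth_proj_eqI[OF assms(1)])
    show "c *\<^sub>C orth_proj S x \<in> S"
      using mem assms(1) by (simp add: csubspace_def)
    fix s assume s: "s \<in> S"
    show "cinner (c *\<^sub>C x - c *\<^sub>C orth_proj S x) s = 0"
      using orth[OF s, of x] by (simp add: cinner_simps)
  qed
  have "(norm x)\<^sup>2 = (norm (x - orth_proj S x))\<^sup>2 + (norm (orth_proj S x))\<^sup>2"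
    using norm_add_square[of "x - orth_proj S x" "orth_proj S x"] orth[OF mem] by simp
  then show "norm (orth_proj S x) \<le> 1 * norm x"
    by (simp add: norm_le_square power2_norm_eq_inner[symmetric])
qed


section \<open>Adjoints\<close>

lemma riesz_representation:
  fixes f :: "'a::chilbert_space \<Rightarrow> complex"
  assumes "bounded_linear f" "\<And>c x. f (c *\<^sub>C x) = c * f x"
  shows "\<exists>z. \<forall>x. f x = cinner x z"
proof (cases "\<forall>x. f x = 0")
  case True
  then show ?thesis by (intro exI[of _ 0]) (simp add: cinner.zero_right)
next
  case False
  then obtain u where u: "f u \<noteq> 0" by blast
  interpret bounded_linear f by fact
  define K where "K = {x. f x = 0}"
  have "csubspace K"
    by (simp add: K_def csubspace_def add zero assms(2))
  moreover have "closed K"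
    unfolding K_def by (intro closed_Collect_eq continuous_intros continuous_on assms(1))
  ultimately obtain p where p: "f p = 0" "\<And>s. f s = 0 \<Longrightarrow> cinner (u - p) s = 0"
    using orth_proj_ex[of K u] unfolding K_def by blast
  \<comment> \<open>\<open>w\<close> is orthogonal to the kernel, and together with the kernel it
    spans the space, so the representing vector is a multiple of \<open>w\<close>. The conjugate in
    the scalar below compensates for conjugate linearity in the second argument.\<close>
  define w where "w = u - p"
  have fw: "f w \<noteq> 0" using u p(1) by (simp add: w_def diff)
  then have w: "w \<noteq> 0" using zero by metis
  have "f x = cinner x ((cnj (f w) / cinner w w) *\<^sub>C w)" for x
  proof -
    have "f (x - (f x / f w) *\<^sub>C w) = 0"
      using fw by (simp add: diff assms(2))
    then have "cinner w (x - (f x / f w) *\<^sub>C w) = 0"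
      using p(2) by (simp add: w_def)
    then have "cinner (x - (f x / f w) *\<^sub>C w) w = 0"
      by (subst cinner_commute) simp
    then have "cinner x w = f x / f w * cinner w w"
      by (simp add: cinner_simps)
    then show ?thesis
      using fw w by (simp add: cinner_scaleC_right cinner_self)
  qed
  then show ?thesis by blast
qed

lemma cadjoint_eqI:
  assumes "\<And>x y. cinner (A x) y = cinner x (B y)"
  shows "cadjoint A = B"
  unfolding cadjoint_def
proof (rule the_equality)
  fix C assume "\<forall>x y. cinner (A x) y = cinner x (C y)"
  then show "C = B"
    using assms by (metis cinner_right_eqI ext)
qed (simp add: assms)

lemma cinner_cadjoint:
  assumes "A \<in> bounded_ops"
  shows "cinner (A x) y = cinner x (cadjoint A y)"
proof -
  have "\<exists>z. \<forall>x. cinner (A x) y = cinner x z" for y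
  proof (rule riesz_representation)
    show "bounded_linear (\<lambda>x. cinner (A x) y)"
      using bounded_linear_compose[OF cinner.bounded_linear_left bounded_ops_bounded_linear[OF assms]] .
  qed (simp add: bounded_ops_scaleC[OF assms] cinner_scaleC_left)
  then obtain B where "\<And>x y. cinner (A x) y = cinner x (B y)" by metis
  then show ?thesis using cadjoint_eqI by metis
qed

lemma cinner_cadjoint': "A \<in> bounded_ops \<Longrightarrow> cinner (cadjoint A x) y = cinner x (A y)"
  by (metis cinner_cadjoint cinner_commute)

lemma cadjoint_cadjoint: "A \<in> bounded_ops \<Longrightarrow> cadjoint (cadjoint A) = A"
  by (rule cadjoint_eqI) (rule cinner_cadjoint')

lemma cadjoint_bounded_ops:
  assumes "A \<in> bounded_ops"
  shows "cadjoint A \<in> bounded_ops"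
proof -
  obtain K where K: "K \<ge> 0" "\<And>x. norm (A x) \<le> norm x * K"
    using bounded_linear.nonneg_bounded[OF bounded_ops_bounded_linear[OF assms]] by blast
  show ?thesis
  proof (rule bounded_opsI)
    fix x y c
    show "cadjoint A (x + y) = cadjoint A x + cadjoint A y"
      by (rule cinner_right_eqI) (simp add: cinner_cadjoint[OF assms, symmetric] cinner_simps)
    show "cadjoint A (c *\<^sub>C x) = c *\<^sub>C cadjoint A x"
      by (rule cinner_right_eqI) (simp add: cinner_cadjoint[OF assms, symmetric] cinner_simps)
    \<comment> \<open>Testing against \<open>z\<close> itself bounds its squared norm by
      \<open>norm z * K * norm x\<close>, and one factor \<open>norm z\<close> cancels unless it is
      zero.\<close>
    define z where "z = cadjoint A x"
    have "complex_of_real ((norm z)\<^sup>2) = cinner (A z) x"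
      by (simp add: z_def cinner_cadjoint[OF assms] cinner_self)
    then have "(norm z)\<^sup>2 = cmod (cinner (A z) x)"
      by (metis abs_norm_cancel norm_of_real norm_power real_norm_def)
    also have "\<dots> \<le> norm (A z) * norm x" by (rule norm_cinner_le)
    also have "\<dots> \<le> norm z * K * norm x" using K(2) by (simp add: mult_right_mono)
    finally have "norm z * norm z \<le> norm z * (K * norm x)"
      by (simp add: power2_eq_square mult.assoc)
    then show "norm z \<le> K * norm x"
      using K(1) by (cases "norm z = 0") (auto simp: mult_le_cancel_left)
  qed
qed

lemma bounded_ops_plus: "A \<in> bounded_ops \<Longrightarrow> B \<in> bounded_ops \<Longrightarrow> (\<lambda>x. A x + B x) \<in> bounded_ops"
  unfolding bounded_ops_def by (auto simp: scaleC_add_right intro: bounded_linear_add)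

lemma bounded_ops_scale: "A \<in> bounded_ops \<Longrightarrow> (\<lambda>x. c *\<^sub>C A x) \<in> bounded_ops"
  unfolding bounded_ops_def
  by (auto simp: scaleC_scaleC mult.commute intro: bounded_linear_compose[OF bounded_linear_scaleC])

text \<open>Preservation of the inner product makes \<open>cadjoint U\<close> a left inverse, and
  surjectivity turns it into a two-sided one.\<close>

lemma unitaryI:
  assumes "U \<in> bounded_ops" "surj U" "\<And>x y. cinner (U x) (U y) = cinner x y"
  shows "unitary U"
proof -
  have 1: "cadjoint U (U x) = x" for x
    by (rule cinner_right_eqI) (simp add: cinner_cadjoint[OF assms(1), symmetric] assms(3))
  moreover have "U (cadjoint U y) = y" for y
    using assms(2) 1 by (metis surjD)
  ultimately show ?thesis
    using assms(1) by (auto simp: unitary_def)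
qed

lemma unitary_cadjoint: "unitary U \<Longrightarrow> unitary (cadjoint U)"
  by (simp add: unitary_def cadjoint_bounded_ops cadjoint_cadjoint)


section \<open>The commutant and its unitaries\<close>

lemma commutantI: "A \<in> bounded_ops \<Longrightarrow> (\<And>B x. B \<in> M \<Longrightarrow> A (B x) = B (A x)) \<Longrightarrow> A \<in> commutant M"
  by (auto simp: commutant_def)

lemma
  assumes "A \<in> commutant M"
  shows commutant_bounded_ops: "A \<in> bounded_ops"
    and commutant_commutes: "B \<in> M \<Longrightarrow> A (B x) = B (A x)"
  using assms unfolding commutant_def by (auto simp: fun_eq_iff)

lemma commutant_plus:
  assumes "M \<subseteq> bounded_ops" "A \<in> commutant M" "B \<in> commutant M"
  shows "(\<lambda>x. A x + B x) \<in> commutant M"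
  using assms
  by (intro commutantI) (auto simp: bounded_ops_plus commutant_bounded_ops commutant_commutes
    bounded_ops_add[OF subsetD[OF assms(1)]])

lemma commutant_scale:
  assumes "M \<subseteq> bounded_ops" "A \<in> commutant M"
  shows "(\<lambda>x. c *\<^sub>C A x) \<in> commutant M"
  using assms
  by (intro commutantI) (auto simp: bounded_ops_scale commutant_bounded_ops commutant_commutes
    bounded_ops_scaleC[OF subsetD[OF assms(1)]])

text \<open>\<open>A\<close> commutes with \<open>cadjoint B\<close>, which lies in
  \<open>M\<close>; the adjoint of this relation is the claim. It lets each unitary of the commutant
  be used together with its inverse.\<close>

lemma commutant_cadjoint:
  assumes "M \<subseteq> bounded_ops" "\<And>B. B \<in> M \<Longrightarrow> cadjoint B \<in> M" "A \<in> commutant M"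
  shows "cadjoint A \<in> commutant M"
proof (rule commutantI)
  have A: "A \<in> bounded_ops" using assms(3) by (rule commutant_bounded_ops)
  then show "cadjoint A \<in> bounded_ops" by (rule cadjoint_bounded_ops)
  fix B x assume B: "B \<in> M"
  then have B': "B \<in> bounded_ops" using assms(1) by blast
  show "cadjoint A (B x) = B (cadjoint A x)"
  proof (rule cinner_right_eqI)
    fix y
    have "cinner y (cadjoint A (B x)) = cinner (cadjoint B (A y)) x"
      by (simp add: cinner_cadjoint[OF A, symmetric] cinner_cadjoint'[OF B'])
    also have "\<dots> = cinner (A (cadjoint B y)) x"
      using assms(2)[OF B] by (simp add: commutant_commutes[OF assms(3)])
    also have "\<dots> = cinner y (B (cadjoint A x))"
      by (simp add: cinner_cadjoint[OF A] cinner_cadjoint'[OF B'])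
    finally show "cinner y (cadjoint A (B x)) = cinner y (B (cadjoint A x))" .
  qed
qed

text \<open>The Cayley transform \<open>(1 + \<i>A)(1 - \<i>A)\<^sup>-\<^sup>1 = 2(1 - \<i>A)\<^sup>-\<^sup>1 - 1\<close> of a self-adjoint \<open>A\<close> is unitary,
  and an operator commuting with it commutes with \<open>A\<close>; the strict contraction makes
  \<open>1 - \<i>A\<close> invertible by Banach's fixed point theorem.\<close>

lemma commutes_contraction_cayley:
  assumes M: "M \<subseteq> bounded_ops" and A: "A \<in> commutant M"
    and sa: "\<And>x y. cinner (A x) y = cinner x (A y)"
    and contr: "0 \<le> r" "r < 1" "\<And>x. norm (A x) \<le> r * norm x"
    and Z: "Z \<in> bounded_ops"
    and commutes: "\<And>U x. U \<in> commutant M \<Longrightarrow> unitary U \<Longrightarrow> Z (U x) = U (Z x)"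
  shows "Z (A x) = A (Z x)"
proof -
  note A' = commutant_bounded_ops[OF A]
  \<comment> \<open>One statement for all unimodular \<open>c\<close>: \<open>\<i>\<close> yields
    the inverse \<open>R\<close> of \<open>1 - \<i>A\<close>, and \<open>- \<i>\<close> later yields
    surjectivity of the Cayley transform.\<close>
  have inv: "\<exists>!x. x - c *\<^sub>C A x = y" if "cmod c = 1" for c y
  proof -
    have "\<exists>!x. y + c *\<^sub>C A x = x"
    proof (rule banach_fix_type[OF contr(1,2)])
      show "\<forall>x z. dist (y + c *\<^sub>C A x) (y + c *\<^sub>C A z) \<le> r * dist x z"
        using contr(3) that
        by (simp add: dist_norm scaleC_diff[symmetric] norm_scaleC bounded_ops_diff[OF A', symmetric])
    qed
    then show ?thesis by (simp add: algebra_simps eq_commute)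
  qed
  then obtain R where R: "\<And>y. R y - \<i> *\<^sub>C A (R y) = y"
    by (metis norm_ii)
  have R_eqI: "R y = x" if "x - \<i> *\<^sub>C A x = y" for x y
    using inv[of \<i> y] R that by auto
  \<comment> \<open>Self-adjointness cancels the cross terms. Since \<open>1 + \<i>A\<close> and
    \<open>1 - \<i>A\<close> produce the same form, their quotient preserves the inner product; the
    second version with equal arguments also bounds \<open>R\<close> by 1.\<close>
  have iso: "cinner (x + \<i> *\<^sub>C A x) (y + \<i> *\<^sub>C A y) = cinner x y + cinner (A x) (A y)" for x y
    using sa[of x y] by (simp add: cinner_simps algebra_simps)
  have iso': "cinner (x - \<i> *\<^sub>C A x) (y - \<i> *\<^sub>C A y) = cinner x y + cinner (A x) (A y)" for x y
    using sa[of x y] by (simp add: cinner_simps algebra_simps)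
  have R_add: "R (x + y) = R x + R y" for x y
  proof (rule R_eqI)
    have "R x + R y - \<i> *\<^sub>C A (R x + R y) = (R x - \<i> *\<^sub>C A (R x)) + (R y - \<i> *\<^sub>C A (R y))"
      by (simp add: bounded_ops_add[OF A'] scaleC_add_right)
    then show "R x + R y - \<i> *\<^sub>C A (R x + R y) = x + y" by (simp add: R)
  qed
  have R_scale: "R (c *\<^sub>C x) = c *\<^sub>C R x" for c x
  proof (rule R_eqI)
    have "c *\<^sub>C R x - \<i> *\<^sub>C A (c *\<^sub>C R x) = c *\<^sub>C (R x - \<i> *\<^sub>C A (R x))"
      by (simp add: bounded_ops_scaleC[OF A'] scaleC_diff scaleC_scaleC mult.commute)
    then show "c *\<^sub>C R x - \<i> *\<^sub>C A (c *\<^sub>C R x) = c *\<^sub>C x" by (simp add: R)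
  qed
  have "norm (R x) \<le> 1 * norm x" for x
  proof -
    have "complex_of_real ((norm x)\<^sup>2) = complex_of_real ((norm (R x))\<^sup>2 + (norm (A (R x)))\<^sup>2)"
      using iso'[of "R x" "R x"] by (simp only: R cinner_self of_real_add)
    then have "(norm x)\<^sup>2 = (norm (R x))\<^sup>2 + (norm (A (R x)))\<^sup>2"
      using of_real_eq_iff by blast
    then have "(norm (R x))\<^sup>2 \<le> (norm x)\<^sup>2" by simp
    then show ?thesis by (simp add: power2_le_iff_abs_le)
  qed
  then have R_bounded: "R \<in> bounded_ops"
    using R_add R_scale by (intro bounded_opsI[where K = 1])
  have R_comm: "R \<in> commutant M"
  proof (rule commutantI[OF R_bounded])
    fix B x assume B: "B \<in> M"
    then have B': "B \<in> bounded_ops" using M by blast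
    have "B (R x) - \<i> *\<^sub>C A (B (R x)) = B (R x - \<i> *\<^sub>C A (R x))"
      by (simp add: bounded_ops_diff[OF B'] bounded_ops_scaleC[OF B'] commutant_commutes[OF A B])
    then show "R (B x) = B (R x)"
      by (intro R_eqI) (simp add: R)
  qed
  define U where "U x = R x + \<i> *\<^sub>C A (R x)" for x
  have U_alt: "U x = 2 *\<^sub>C R x + (- 1) *\<^sub>C x" for x
  proof -
    have "2 *\<^sub>C R x = R x + R x"
      using scaleC_add_left[of 1 1 "R x"] by simp
    then show ?thesis
      using R[of x] by (simp add: U_def scaleC_minus_one algebra_simps)
  qed
  have id: "(\<lambda>x. x) \<in> commutant M"
    by (rule commutantI) (simp_all add: bounded_opsI[where K = 1])
  have U_comm: "U \<in> commutant M"
    unfolding U_alt[abs_def] by (intro commutant_plus commutant_scale M R_comm id)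
  have "unitary U"
  proof (rule unitaryI)
    show "U \<in> bounded_ops" using U_comm by (rule commutant_bounded_ops)
    show "cinner (U x) (U y) = cinner x y" for x y
      using iso[of "R x" "R y"] iso'[of "R x" "R y"] by (simp add: U_def R)
    show "surj U"
      unfolding surj_def
    proof
      fix y
      obtain x where x: "x - (- \<i>) *\<^sub>C A x = y"
        using inv[of "- \<i>" y] by auto
      have "(- \<i>) *\<^sub>C A x = - (\<i> *\<^sub>C A x)"
        using scaleC_scaleC[of "- 1" \<i> "A x"] by (simp add: scaleC_minus_one)
      then have "U (x - \<i> *\<^sub>C A x) = y"
        using x R_eqI[OF refl, of x] by (simp add: U_def)
      then show "\<exists>z. y = U z" by blast
    qed
  qed
  then have "Z (U x) = U (Z x)" for x
    using commutes[OF U_comm] by blast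
  then have "2 *\<^sub>C Z (R x) = 2 *\<^sub>C R (Z x)" for x
    by (simp add: U_alt bounded_ops_add[OF Z] bounded_ops_scaleC[OF Z])
  then have "(1 / 2) *\<^sub>C 2 *\<^sub>C Z (R x) = (1 / 2) *\<^sub>C 2 *\<^sub>C R (Z x)" for x
    by simp
  then have ZR: "Z (R x) = R (Z x)" for x
    by (simp add: scaleC_scaleC)
  \<comment> \<open>Commutation with \<open>R\<close> passes to its inverse
    \<open>1 - \<i>A\<close>, and from there to \<open>A\<close>.\<close>
  have "R (Z x - \<i> *\<^sub>C Z (A x)) = Z x"
    using ZR[of "x - \<i> *\<^sub>C A x"] R_eqI[OF refl, of x]
    by (simp add: bounded_ops_diff[OF Z] bounded_ops_scaleC[OF Z])
  then have "Z x - \<i> *\<^sub>C A (Z x) = Z x - \<i> *\<^sub>C Z (A x)"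
    using R by metis
  then have "(- \<i>) *\<^sub>C \<i> *\<^sub>C A (Z x) = (- \<i>) *\<^sub>C \<i> *\<^sub>C Z (A x)"
    by simp
  then show ?thesis
    by (simp add: scaleC_scaleC)
qed

lemma commutes_self_adjoint:
  assumes M: "M \<subseteq> bounded_ops" and A: "A \<in> commutant M"
    and sa: "\<And>x y. cinner (A x) y = cinner x (A y)"
    and Z: "Z \<in> bounded_ops"
    and commutes: "\<And>U x. U \<in> commutant M \<Longrightarrow> unitary U \<Longrightarrow> Z (U x) = U (Z x)"
  shows "Z (A x) = A (Z x)"
proof -
  obtain K where K: "K > 0" "\<And>x. norm (A x) \<le> norm x * K"
    using bounded_linear.pos_bounded[OF bounded_ops_bounded_linear[OF commutant_bounded_ops[OF A]]]
    by blast
  \<comment> \<open>Commutation is insensitive to a nonzero factor; this one makes the multiple of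
    \<open>A\<close> contract with ratio 1/2.\<close>
  define t where "t = 1 / (2 * K)"
  have t: "t > 0" "t * K = 1 / 2" using K(1) by (simp_all add: t_def)
  have "Z (t *\<^sub>C A x) = t *\<^sub>C A (Z x)"
  proof (rule commutes_contraction_cayley[OF M commutant_scale[OF M A] _ _ _ _ Z commutes])
    show "cinner (complex_of_real t *\<^sub>C A x) y = cinner x (complex_of_real t *\<^sub>C A y)" for x y
      by (simp add: cinner_simps sa)
    show "norm (complex_of_real t *\<^sub>C A x) \<le> 1 / 2 * norm x" for x
      using mult_left_mono[OF K(2)[of x], of t] t by (simp add: norm_scaleC mult.left_commute[of t "norm x"])
  qed auto
  then have "t *\<^sub>R Z (A x) = t *\<^sub>R A (Z x)"
    by (simp add: scaleR_scaleC bounded_ops_scaleC[OF Z])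
  then show ?thesis using t(1) by simp
qed

lemma commutes_commutant:
  assumes M: "M \<subseteq> bounded_ops" "\<And>B. B \<in> M \<Longrightarrow> cadjoint B \<in> M" and A: "A \<in> commutant M"
    and Z: "Z \<in> bounded_ops"
    and commutes: "\<And>U x. U \<in> commutant M \<Longrightarrow> unitary U \<Longrightarrow> Z (U x) = U (Z x)"
  shows "Z (A x) = A (Z x)"
proof -
  note A' = commutant_bounded_ops[OF A]
  note adj = commutant_cadjoint[OF M A]
  \<comment> \<open>\<open>B\<close> is twice the real part of \<open>A\<close> and \<open>C\<close>
    minus twice its imaginary part; both are self-adjoint, and
    \<open>2A = B - \<i>C\<close>.\<close>
  define B where "B x = A x + cadjoint A x" for x
  define C where "C x = \<i> *\<^sub>C A x + (- \<i>) *\<^sub>C cadjoint A x" for x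
  have "Z (B x) = B (Z x)"
  proof (rule commutes_self_adjoint[OF M(1) _ _ Z commutes])
    show "B \<in> commutant M"
      unfolding B_def[abs_def] by (intro commutant_plus M A adj)
    show "cinner (B x) y = cinner x (B y)" for x y
      by (simp add: B_def cinner_simps cinner_cadjoint[OF A'] cinner_cadjoint'[OF A'])
  qed
  moreover have "Z (C x) = C (Z x)"
  proof (rule commutes_self_adjoint[OF M(1) _ _ Z commutes])
    show "C \<in> commutant M"
      unfolding C_def[abs_def] by (intro commutant_plus commutant_scale M A adj)
    show "cinner (C x) y = cinner x (C y)" for x y
      by (simp add: C_def cinner_simps cinner_cadjoint[OF A'] cinner_cadjoint'[OF A'])
  qed
  moreover have "2 *\<^sub>C A x = B x + (- \<i>) *\<^sub>C C x" for x
    using scaleC_add_left[of 1 1 "A x"]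
    by (simp add: B_def C_def scaleC_add_right scaleC_scaleC scaleC_minus_one)
  ultimately have "2 *\<^sub>C Z (A x) = 2 *\<^sub>C A (Z x)"
    by (metis bounded_ops_add[OF Z] bounded_ops_scaleC[OF Z])
  then have "(1 / 2) *\<^sub>C 2 *\<^sub>C Z (A x) = (1 / 2) *\<^sub>C 2 *\<^sub>C A (Z x)"
    by simp
  then show ?thesis by (simp add: scaleC_scaleC)
qed


section \<open>The double commutant theorem\<close>

text \<open>Projecting the family \<open>x\<close> onto the closure of \<open>{(A (x i))\<^sub>i. A \<in> M}\<close> gives a matrix with entries
  \<open>P i j\<close> in the commutant; the entries commute with \<open>Z\<close>, so this closure is invariant under \<open>Z\<close>, and
  it contains \<open>x\<close>.\<close>

lemma double_commutant_approximation:
  fixes M :: "('a::chilbert_space \<Rightarrow> 'a) set" and x :: "'b \<Rightarrow> 'a"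
  assumes "von_neumann_algebra M" "Z \<in> bounded_ops" "finite I"
    and commutes: "\<And>A y. A \<in> commutant M \<Longrightarrow> Z (A y) = A (Z y)"
  shows "\<exists>A. (\<forall>k::nat. A k \<in> M) \<and> (\<forall>i\<in>I. (\<lambda>k. A k (x i)) \<longlonglongrightarrow> Z (x i))"
proof -
  have M: "M \<subseteq> bounded_ops" "id \<in> M"
    "\<And>A B. A \<in> M \<Longrightarrow> B \<in> M \<Longrightarrow> (\<lambda>x. A x + B x) \<in> M"
    "\<And>c A. A \<in> M \<Longrightarrow> (\<lambda>x. c *\<^sub>C A x) \<in> M"
    "\<And>A B. A \<in> M \<Longrightarrow> B \<in> M \<Longrightarrow> A \<circ> B \<in> M"
    "\<And>A. A \<in> M \<Longrightarrow> cadjoint A \<in> M"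
    using assms(1) unfolding von_neumann_algebra_def by blast+
  define S where "S = (\<lambda>A i. A (x i)) ` M"
  have SI: "(\<lambda>i. A (x i)) \<in> S" if "A \<in> M" for A
    unfolding S_def using that by blast
  have S_comp: "(\<lambda>i. B (s i)) \<in> S" if "B \<in> M" "s \<in> S" for B s
    using that SI[OF M(5)] unfolding S_def by fastforce
  interpret family_subspace I S
  proof
    show "S \<noteq> {}" using SI[OF M(2)] by blast
    show "(\<lambda>i. s i + t i) \<in> S" if "s \<in> S" "t \<in> S" for s t
      using that SI[OF M(3)] unfolding S_def by fastforce
    show "(\<lambda>i. c *\<^sub>C s i) \<in> S" if "s \<in> S" for s c
      using that SI[OF M(4)] unfolding S_def by fastforce
  qed fact
  \<comment> \<open>Acting in every coordinate, \<open>B\<close> and its adjoint both map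
    \<open>S\<close> into itself, so \<open>B\<close> commutes with the projection onto the
    closure.\<close>
  have is_proj_apply: "is_proj (\<lambda>i. B (h i)) (\<lambda>i. B (p i))" if "B \<in> M" "is_proj h p" for B h p
  proof -
    have B: "B \<in> bounded_ops" using M(1) \<open>B \<in> M\<close> by blast
    obtain s where "\<forall>k. s k \<in> S" "\<forall>i\<in>I. (\<lambda>k. s k i) \<longlonglongrightarrow> p i"
      using \<open>is_proj h p\<close> unfolding is_proj_def limit_family_def by blast
    then have "limit_family (\<lambda>i. B (p i))"
      unfolding limit_family_def
      by (intro exI[of _ "\<lambda>k i. B (s k i)"])
        (auto intro: S_comp[OF \<open>B \<in> M\<close>] bounded_linear.tendsto[OF bounded_ops_bounded_linear[OF B]])
    moreover have "(\<Sum>i\<in>I. cinner (B (h i) - B (p i)) (s i)) = 0" if "s \<in> S" for s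
      using \<open>is_proj h p\<close> S_comp[OF M(6)[OF \<open>B \<in> M\<close>] that]
      by (simp add: is_proj_def bounded_ops_diff[OF B, symmetric] cinner_cadjoint[OF B])
    ultimately show ?thesis unfolding is_proj_def by blast
  qed
  \<comment> \<open>\<open>e j h\<close> puts \<open>h\<close> into slot \<open>j\<close>, so
    \<open>P i j\<close> is an entry of the matrix of the projection.\<close>
  define e where "e j h = (\<lambda>k. if k = j then h else 0)" for j :: 'b and h :: 'a
  define P where "P i j h = proj (e j h) i" for i j h
  have P_commutant: "P i j \<in> commutant M" if "i \<in> I" "j \<in> I" for i j
  proof (rule commutantI)
    show "P i j \<in> bounded_ops"
    proof (rule bounded_opsI[where K = 1])
      fix g h c
      have "e j (g + h) = (\<lambda>k. e j g k + e j h k)" "e j (c *\<^sub>C h) = (\<lambda>k. c *\<^sub>C e j h k)"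
        by (auto simp: e_def scaleC_zero_right)
      then show "P i j (g + h) = P i j g + P i j h" "P i j (c *\<^sub>C h) = c *\<^sub>C P i j h"
        unfolding P_def
        by (auto intro!: proj_eqI[OF _ that(1)] is_proj_add[OF is_proj_proj is_proj_proj]
          is_proj_scaleC[OF is_proj_proj])
      have "(norm (P i j h))\<^sup>2 \<le> (\<Sum>k\<in>I. (norm (proj (e j h) k))\<^sup>2)"
        unfolding P_def using that(1) finite_index by (intro member_le_sum) auto
      also have "\<dots> \<le> (\<Sum>k\<in>I. (norm (e j h k))\<^sup>2)"
        by (rule is_proj_norm_le[OF is_proj_proj])
      also have "\<dots> = (\<Sum>k\<in>I. if k = j then (norm h)\<^sup>2 else 0)"
        by (intro sum.cong) (auto simp: e_def)
      also have "\<dots> = (norm h)\<^sup>2"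
        using that(2) finite_index by simp
      finally show "norm (P i j h) \<le> 1 * norm h"
        by (simp add: power2_le_iff_abs_le)
    qed
    fix B h assume B: "B \<in> M"
    then have "B 0 = 0" using M(1) bounded_ops_zero by blast
    then have "e j (B h) = (\<lambda>k. B (e j h k))"
      by (auto simp: e_def)
    then show "P i j (B h) = B (P i j h)"
      unfolding P_def by (auto intro!: proj_eqI[OF _ that(1)] is_proj_apply[OF B is_proj_proj])
  qed
  have is_proj_sum: "is_proj (\<lambda>i. \<Sum>j\<in>J. e j (y j) i) (\<lambda>i. \<Sum>j\<in>J. P i j (y j))" if "finite J" for J y
    using that
  proof (induction J)
    case empty
    then show ?case by (simp add: is_proj_def limit_family_mem zero_mem cinner.zero_left)
  next
    case (insert j J)
    then show ?case
      using is_proj_add[OF is_proj_proj[of "e j (y j)"]] by (simp add: P_def)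
  qed
  \<comment> \<open>\<open>x\<close> lies in \<open>S\<close> because \<open>id\<close> lies in
    \<open>M\<close>, so it is its own projection; splitting it into slots brings in the entries
    \<open>P i j\<close>.\<close>
  have "is_proj (\<lambda>i. \<Sum>j\<in>I. e j (x j) i) x"
    using limit_family_mem[OF SI[OF M(2)]] finite_index
    by (simp add: is_proj_def e_def cinner.zero_left)
  then have x_eq: "x i = (\<Sum>j\<in>I. P i j (x j))" if "i \<in> I" for i
    using is_proj_unique[OF _ is_proj_sum[OF finite_index] that] by blast
  \<comment> \<open>\<open>Z\<close> passes through the entries, so the family of all
    \<open>Z (x i)\<close> is fixed by the projection and hence a limit of members of
    \<open>S\<close>.\<close>
  have Z_eq: "Z (x i) = (\<Sum>j\<in>I. P i j (Z (x j)))" if "i \<in> I" for i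
    by (subst x_eq[OF that])
      (simp add: bounded_ops_sum[OF assms(2)] commutes[OF P_commutant[OF that]])
  define z where "z i = (\<Sum>j\<in>I. P i j (Z (x j)))" for i
  have z: "z i = Z (x i)" if "i \<in> I" for i
    unfolding z_def by (rule Z_eq[OF that, symmetric])
  have "limit_family z"
    unfolding z_def[abs_def]
    using is_proj_sum[OF finite_index] unfolding is_proj_def by (rule conjunct1)
  then obtain s where s: "\<And>k. s k \<in> S" "\<And>i. i \<in> I \<Longrightarrow> (\<lambda>k. s k i) \<longlonglongrightarrow> Z (x i)"
    unfolding limit_family_def by (auto simp: z)
  have "\<exists>A. A \<in> M \<and> s k = (\<lambda>i. A (x i))" for k
    using s(1)[of k] unfolding S_def by blast
  then obtain A where "\<And>k. A k \<in> M" "\<And>k. s k = (\<lambda>i. A k (x i))"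
    by metis
  then show ?thesis using s(2) by auto
qed

text \<open>A weak neighbourhood of \<open>Z\<close> that misses \<open>M\<close> contains one
  restricting only finitely many coefficients \<open>cinner (Z x) y\<close>, and norm approximation
  at the finitely many vectors \<open>x\<close> enters it.\<close>

theorem double_commutant:
  assumes "von_neumann_algebra M" "Z \<in> bounded_ops"
    and "\<And>A x. A \<in> commutant M \<Longrightarrow> Z (A x) = A (Z x)"
  shows "Z \<in> M"
proof (rule ccontr)
  assume "Z \<notin> M"
  define f :: "('a \<Rightarrow> 'a) \<Rightarrow> 'a \<times> 'a \<Rightarrow> complex" where "f A = (\<lambda>(x, y). cinner (A x) y)" for A
  have M: "M \<subseteq> bounded_ops" "closedin (pullback_topology bounded_ops f euclidean) M"
    using assms(1) unfolding von_neumann_algebra_def weak_operator_topology_def f_def by blast+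
  then have "openin (pullback_topology bounded_ops f euclidean) (bounded_ops - M)"
    by (simp add: closedin_def topspace_pullback_topology)
  then obtain W where W: "open W" "bounded_ops - M = f -` W \<inter> bounded_ops"
    by (auto simp: openin_pullback_topology)
  then have "f Z \<in> W" using \<open>Z \<notin> M\<close> assms(2) by blast
  then obtain X where X: "f Z \<in> (\<Pi>\<^sub>E i\<in>UNIV. X i)" "\<And>i. open (X i)" "finite {i. X i \<noteq> UNIV}"
    "(\<Pi>\<^sub>E i\<in>UNIV. X i) \<subseteq> W"
    using product_topology_open_contains_basis[of "\<lambda>i. euclidean" UNIV W "f Z"] W(1)
    unfolding open_fun_def by auto
  \<comment> \<open>The index set consists of the constrained pairs, with \<open>fst\<close> as the
    family: only the first vectors need approximation, the second ones stay fixed in the continuous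
    inner product.\<close>
  obtain A where A: "\<And>k::nat. A k \<in> M" "\<And>i. X i \<noteq> UNIV \<Longrightarrow> (\<lambda>k. A k (fst i)) \<longlonglongrightarrow> Z (fst i)"
    using double_commutant_approximation[OF assms(1,2) X(3) assms(3), of fst] by blast
  have "\<forall>\<^sub>F k in sequentially. f (A k) i \<in> X i" if "X i \<noteq> UNIV" for i
  proof (rule topological_tendstoD)
    show "(\<lambda>k. f (A k) i) \<longlonglongrightarrow> f Z i"
      using A(2)[OF that] by (auto simp: f_def split_beta intro: cinner.tendsto)
    show "f Z i \<in> X i" using X(1) by auto
  qed (rule X(2))
  then have "\<forall>\<^sub>F k in sequentially. \<forall>i\<in>{i. X i \<noteq> UNIV}. f (A k) i \<in> X i"
    using X(3) by (intro eventually_ball_finite) auto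
  then obtain k where "\<forall>i\<in>{i. X i \<noteq> UNIV}. f (A k) i \<in> X i"
    using eventually_happens sequentially_bot by blast
  then have "f (A k) \<in> (\<Pi>\<^sub>E i\<in>UNIV. X i)" by auto
  then have "A k \<in> bounded_ops - M" using X(4) W(2) A(1) M(1) by blast
  then show False using A(1) by blast
qed


section \<open>Affiliated operators\<close>

text \<open>Because the adjoint \<open>W\<close> preserves \<open>S\<close>, \<open>V\<close>
  preserves the orthogonal complement too. Giving \<open>W\<close> by the adjoint identity spares
  computing \<open>cadjoint\<close> of a direct sum.\<close>

lemma orth_proj_commutes:
  assumes S: "csubspace S" "closed S"
    and V: "V \<in> bounded_ops" "V ` S \<subseteq> S"
    and W: "\<And>x y. cinner (V x) y = cinner x (W y)" "W ` S \<subseteq> S"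
  shows "orth_proj S (V x) = V (orth_proj S x)"
proof (rule orth_proj_eqI[OF S(1)])
  show "V (orth_proj S x) \<in> S"
    using V(2) orth_proj_mem[OF S] by blast
  show "cinner (V x - V (orth_proj S x)) s = 0" if "s \<in> S" for s
    using orth_proj_orthogonal[OF S, of "W s" x] W(2) that
    by (auto simp: bounded_ops_diff[OF V(1), symmetric] W(1))
qed

lemma map_prod_bounded_ops:
  assumes "A \<in> bounded_ops"
  shows "map_prod A A \<in> bounded_ops"
proof -
  have "bounded_linear (\<lambda>p. (A (fst p), A (snd p)))"
    by (intro bounded_linear_Pair bounded_linear_compose[OF bounded_ops_bounded_linear[OF assms]]
        bounded_linear_fst bounded_linear_snd)
  moreover have "map_prod A A = (\<lambda>p. (A (fst p), A (snd p)))"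
    by (simp add: fun_eq_iff)
  ultimately show ?thesis
    by (simp add: bounded_ops_def scaleC_prod_def bounded_ops_scaleC[OF assms])
qed

lemma matrix_entry_bounded_ops:
  assumes "P \<in> bounded_ops"
  shows "summand_proj i \<circ> P \<circ> summand_inj j \<in> bounded_ops"
proof -
  have "bounded_linear (summand_proj i)"
    by (cases "i = 1") (simp_all add: summand_proj_def[abs_def] bounded_linear_fst bounded_linear_snd)
  moreover have "bounded_linear (summand_inj j)"
    by (cases "j = 1") (simp_all add: summand_inj_def[abs_def] bounded_linear_Pair)
  ultimately have "bounded_linear (\<lambda>x. summand_proj i (P (summand_inj j x)))"
    using bounded_linear_compose bounded_linear_compose[OF bounded_ops_bounded_linear[OF assms]]
    by blast
  moreover have "summand_inj j (c *\<^sub>C x) = c *\<^sub>C summand_inj j x" for c and x :: 'a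
    by (simp add: summand_inj_def scaleC_prod_def scaleC_zero_right)
  moreover have "summand_proj i (c *\<^sub>C p) = c *\<^sub>C summand_proj i p" for c and p :: "'a \<times> 'a"
    by (simp add: summand_proj_def scaleC_prod_def)
  ultimately show ?thesis
    by (simp add: bounded_ops_def comp_def bounded_ops_scaleC[OF assms])
qed

lemma csubspace_graph: "linear_operator T \<Longrightarrow> csubspace (Map.graph T)"
  by (auto simp: linear_operator_def csubspace_def Map.graph_def zero_prod_def scaleC_prod_def)

text \<open>For a single unitary, invariance of the graph gives only one inclusion between
  \<open>T\<close> and its conjugate. The adjoint is again a unitary of the commutant and supplies
  the other, and with it equality of domains.\<close>

lemma mvn_affiliated_iff:
  assumes M: "M \<subseteq> bounded_ops" "\<And>B. B \<in> M \<Longrightarrow> cadjoint B \<in> M" and T: "closed_operator T"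
  shows "T \<in> mvn_affiliated M \<longleftrightarrow>
    (\<forall>U\<in>commutant M. unitary U \<longrightarrow> map_prod U U ` Map.graph T \<subseteq> Map.graph T)"
proof -
  have comp: "((Some \<circ> cadjoint U) \<circ>\<^sub>m T \<circ>\<^sub>m (Some \<circ> U)) x = map_option (cadjoint U) (T (U x))"
    for U and x
    by (cases "T (U x)") (simp_all add: map_comp_def)
  have inv: "cadjoint U (U x) = x" "U (cadjoint U x) = x" if "unitary U" for U :: "'a \<Rightarrow> 'a" and x
    using that by (auto simp: unitary_def fun_eq_iff)
  have graph: "map_prod U U ` Map.graph T \<subseteq> Map.graph T \<longleftrightarrow>
      (\<forall>x u. T x = Some u \<longrightarrow> T (U x) = Some (U u))" for U
    by (auto simp: Map.graph_def)
  show ?thesis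
  proof
    assume "T \<in> mvn_affiliated M"
    then have eq: "map_option (cadjoint U) (T (U x)) = T x" if "U \<in> commutant M" "unitary U" for U x
      using that by (simp add: mvn_affiliated_def comp[symmetric])
    have "T (U x) = Some (U u)" if U: "U \<in> commutant M" "unitary U" and "T x = Some u" for U x u
      using eq[OF U, of x] \<open>T x = Some u\<close> inv(2)[OF U(2)] by auto
    then show "\<forall>U\<in>commutant M. unitary U \<longrightarrow> map_prod U U ` Map.graph T \<subseteq> Map.graph T"
      unfolding graph by blast
  next
    assume r: "\<forall>U\<in>commutant M. unitary U \<longrightarrow> map_prod U U ` Map.graph T \<subseteq> Map.graph T"
    have "map_option (cadjoint U) (T (U x)) = T x" if U: "U \<in> commutant M" "unitary U" for U x
    proof -
      have 1: "T x = Some u \<Longrightarrow> T (U x) = Some (U u)" for u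
        using r U unfolding graph by blast
      have 2: "T (U x) = Some v \<Longrightarrow> T x = Some (cadjoint U v)" for v
        using r[unfolded graph, rule_format, OF commutant_cadjoint[OF M U(1)] unitary_cadjoint[OF U(2)],
          of "U x" v]
        by (simp add: inv[OF U(2)])
      show ?thesis
        using 1 2 by (cases "T (U x)"; cases "T x") auto
    qed
    then show "T \<in> mvn_affiliated M"
      using T by (simp add: mvn_affiliated_def fun_eq_iff comp del: map_comp_simps)
  qed
qed

theorem lemma5p2:
  fixes M :: "('a::chilbert_space \<Rightarrow> 'a) set" and T :: "'a \<rightharpoonup> 'a"
  assumes "von_neumann_algebra M"
    and "closed_operator T"
  shows "T \<in> mvn_affiliated M \<longleftrightarrow> op_matrix (char_proj T) \<in> mat2 M"
proof -
  have M: "M \<subseteq> bounded_ops" "\<And>A. A \<in> M \<Longrightarrow> cadjoint A \<in> M"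
    using assms(1) unfolding von_neumann_algebra_def by blast+
  define G where "G = Map.graph T"
  have G: "csubspace G" "closed G"
    using assms(2) csubspace_graph unfolding closed_operator_def G_def by blast+
  define P where "P = orth_proj G"
  have P: "P \<in> bounded_ops" unfolding P_def using G by (rule orth_proj_bounded_ops)
  define E where "E i j = summand_proj i \<circ> P \<circ> summand_inj j" for i j
  have E: "E i j \<in> bounded_ops" for i j
    unfolding E_def using P by (rule matrix_entry_bounded_ops)
  \<comment> \<open>\<open>G\<close> is closed, so the closure in \<open>char_proj\<close> changes
    nothing.\<close>
  have mat: "op_matrix (char_proj T) \<in> mat2 M \<longleftrightarrow> (\<forall>i j. E i j \<in> M)"
    using G(2) by (simp add: op_matrix_def char_proj_def mat2_def E_def P_def G_def)
  have affiliated: "T \<in> mvn_affiliated M \<longleftrightarrow> (\<forall>U\<in>commutant M. unitary U \<longrightarrow> map_prod U U ` G \<subseteq> G)"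
    unfolding G_def using M assms(2) by (rule mvn_affiliated_iff)
  show ?thesis
    unfolding mat affiliated
  proof
    assume r: "\<forall>U\<in>commutant M. unitary U \<longrightarrow> map_prod U U ` G \<subseteq> G"
    have "E i j (U x) = U (E i j x)" if U: "U \<in> commutant M" "unitary U" for U x i j
    proof -
      have U': "U \<in> bounded_ops" using U(1) by (rule commutant_bounded_ops)
      have "P (map_prod U U p) = map_prod U U (P p)" for p
        unfolding P_def
      proof (rule orth_proj_commutes[OF G map_prod_bounded_ops[OF U']])
        show "map_prod U U ` G \<subseteq> G" using r U by blast
        show "map_prod (cadjoint U) (cadjoint U) ` G \<subseteq> G"
          using r commutant_cadjoint[OF M U(1)] unitary_cadjoint[OF U(2)] by blast
        show "cinner (map_prod U U x) y = cinner x (map_prod (cadjoint U) (cadjoint U) y)" for x y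
          by (simp add: cinner_prod_def cinner_cadjoint[OF U'])
      qed
      moreover have "summand_inj j (U x) = map_prod U U (summand_inj j x)"
        by (simp add: summand_inj_def bounded_ops_zero[OF U'])
      ultimately show ?thesis
        by (simp add: E_def summand_proj_def)
    qed
    then show "\<forall>i j. E i j \<in> M"
      using double_commutant[OF assms(1) E] commutes_commutant[OF M _ E] by blast
  next
    assume r: "\<forall>i j. E i j \<in> M"
    have "map_prod U U p \<in> G" if U: "U \<in> commutant M" "unitary U" "p \<in> G" for U p
    proof -
      have U': "U \<in> bounded_ops" using U(1) by (rule commutant_bounded_ops)
      \<comment> \<open>The matrix acting on a column: commutation of the four entries with
        \<open>U\<close> becomes commutation of \<open>P\<close> with
        \<open>map_prod U U\<close>.\<close>
      have split: "P (a, b) = (E 1 1 a + E 1 2 b, E 2 1 a + E 2 2 b)" for a b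
        using bounded_ops_add[OF P, of "(a, 0)" "(0, b)"]
        by (simp add: E_def summand_inj_def summand_proj_def prod_eq_iff)
      have "E i j (U x) = U (E i j x)" for i j x
        using commutant_commutes[OF U(1)] r by metis
      then have "P (map_prod U U p) = map_prod U U (P p)"
        by (cases p) (simp add: split bounded_ops_add[OF U'])
      \<comment> \<open>A vector of \<open>G\<close> is its own projection, so its image under
        \<open>map_prod U U\<close> is a value of \<open>P\<close> and lies in
        \<open>G\<close>.\<close>
      moreover have "P p = p"
        unfolding P_def by (rule orth_proj_eqI[OF G(1) U(3)]) (simp add: cinner.zero_left)
      ultimately show ?thesis
        using orth_proj_mem[OF G, of "map_prod U U p"] by (simp add: P_def)
    qed
    then show "\<forall>U\<in>commutant M. unitary U \<longrightarrow> map_prod U U ` G \<subseteq> G"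
      by (intro ballI impI image_subsetI)
  qed
qed

end
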